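(* Let $\Gamma$ be a discrete subgroup of $SL(2,\mathbb{R})$ and let $k,n$ be integers with $n\ge0$ and $k>n$. Then there is a canonical isomorphism of complex vector spaces \[\widehat{M}^{n+1}_k(\Gamma,\rho_n)\cong QP^n_{k+n}(\Gamma).\]
   Context: $\mathcal{H}$ is the upper half plane with the action of $SL(2,\mathbb{R})$ by linear fractional transformations; for $\gamma=\begin{pmatrix}a&b\\c&d\end{pmatrix}$ write $\mathfrak{J}(\gamma,z)=cz+d$ and $\mathfrak{K}(\gamma,z)=c/(cz+d)$. For a representation $\rho:\Gamma\to GL(N,\mathbb{C})$ and an integer $k$, $\widehat{M}^N_k(\Gamma,\rho)$ is the space of holomorphic $F:\mathcal{H}\to\mathbb{C}^N$ with $\mathfrak{J}(\gamma,z)^{-k}F(\gamma z)=\rho(\gamma)F(z)$ for all $\gamma\in\Gamma$ (no growth condition at cusps). $\rho_n:SL(2,\mathbb{R})\to GL(n+1,\mathbb{R})$ is the $n$-th symmetric tensor representation, defined by $\rho_n(\gamma)\binom{z_1}{z_2}^n=\left(\gamma\binom{z_1}{z_2}\right)^n$ with $\binom{z_1}{z_2}^n:={}^t(z_1^n,z_1^{n-1}z_2,\ldots,z_2^n)$. For integers $\lambda$ and $m\ge0$, $QP^m_\lambda(\Gamma)$ (quasimodular polynomials of weight $\lambda$ and degree at most $m$) is the space of polynomials $\Phi(z,X)=\sum_{r=0}^m\phi_r(z)X^r$ with $\phi_r$ holomorphic on $\mathcal{H}$ such that $\mathfrak{J}(\gamma,z)^{-\lambda}\Phi\bigl(\gamma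 z,\mathfrak{J}(\gamma,z)^2(X-\mathfrak{K}(\gamma,z))\bigr)=\Phi(z,X)$ for all $\gamma\in\Gamma$. *)

theory Defs
  imports
    "HOL-Analysis.Analysis"
    "HOL-Computational_Algebra.Polynomial"
    "HOL-Algebra.Group"
    "Jordan_Normal_Form.Matrix"
begin

(* \<open>$\<close> is reserved for the entries of the 2x2 matrices of type \<open>real^2^2\<close>. *)
no_notation vec_index (infixl \<open>$\<close> 100)

section \<open>The group and its action on the upper half plane\<close>

definition upper_half_plane :: "complex set" where
  "upper_half_plane = {z. Im z > 0}"

definition SL2R :: "(real^2^2) monoid" where
  "SL2R = \<lparr>carrier = {A. det A = 1}, mult = (**), one = Finite_Cartesian_Product.mat 1\<rparr>"

definition discrete_subgroup :: "(real^2^2) set \<Rightarrow> bool" where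
  "discrete_subgroup \<Gamma> \<longleftrightarrow> subgroup \<Gamma> SL2R \<and> discrete \<Gamma>"

definition act :: "real^2^2 \<Rightarrow> complex \<Rightarrow> complex" where
  "act \<gamma> z = moebius (of_real (\<gamma>$1$1)) (of_real (\<gamma>$1$2)) (of_real (\<gamma>$2$1)) (of_real (\<gamma>$2$2)) z"

definition JJ :: "real^2^2 \<Rightarrow> complex \<Rightarrow> complex" where
  "JJ \<gamma> z = of_real (\<gamma>$2$1) * z + of_real (\<gamma>$2$2)"

definition KK :: "real^2^2 \<Rightarrow> complex \<Rightarrow> complex" where
  "KK \<gamma> z = of_real (\<gamma>$2$1) / JJ \<gamma> z"

section \<open>Symmetric tensor representations\<close>

definition sym_vec :: "nat \<Rightarrow> complex \<Rightarrow> complex \<Rightarrow> complex Matrix.vec" where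
  "sym_vec n z1 z2 = Matrix.vec (n + 1) (\<lambda>i. z1 ^ (n - i) * z2 ^ i)"

definition is_sym_mat :: "nat \<Rightarrow> real^2^2 \<Rightarrow> real Matrix.mat \<Rightarrow> bool" where
  "is_sym_mat n \<gamma> M \<longleftrightarrow> M \<in> carrier_mat (n + 1) (n + 1) \<and>
     (\<forall>z1 z2. map_mat complex_of_real M *\<^sub>v sym_vec n z1 z2 =
        sym_vec n (of_real (\<gamma>$1$1) * z1 + of_real (\<gamma>$1$2) * z2)
                  (of_real (\<gamma>$2$1) * z1 + of_real (\<gamma>$2$2) * z2))"

definition sym_rep :: "nat \<Rightarrow> real^2^2 \<Rightarrow> real Matrix.mat" where
  "sym_rep n \<gamma> = (THE M. is_sym_mat n \<gamma> M)"

definition sym_repC :: "nat \<Rightarrow> real^2^2 \<Rightarrow> complex Matrix.mat" where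
  "sym_repC n \<gamma> = map_mat complex_of_real (sym_rep n \<gamma>)"

lemma linear_forms_expand:
  fixes a b c d :: real
  shows "\<exists>h :: nat \<Rightarrow> real. \<forall>z1 z2 :: complex.
    (of_real a * z1 + of_real b * z2) ^ p * (of_real c * z1 + of_real d * z2) ^ q =
      (\<Sum>j\<le>p + q. of_real (h j) * (z1 ^ (p + q - j) * z2 ^ j))"
proof -
  have step: "\<exists>h' :: nat \<Rightarrow> real. \<forall>z1 z2 :: complex.
      (of_real u * z1 + of_real v * z2) * f z1 z2 =
        (\<Sum>j\<le>Suc m. of_real (h' j) * (z1 ^ (Suc m - j) * z2 ^ j))"
    if f: "\<forall>z1 z2. f z1 z2 = (\<Sum>j\<le>m. of_real (h j) * (z1 ^ (m - j) * z2 ^ j))"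
    for u v :: real and m :: nat and h :: "nat \<Rightarrow> real" and f :: "complex \<Rightarrow> complex \<Rightarrow> complex"
  proof (intro exI allI)
    fix z1 z2 :: complex
    let ?h' = "\<lambda>j. (if j \<le> m then u * h j else 0) + (if j = 0 then 0 else v * h (j - 1))"
    have 1: "of_real u * z1 * f z1 z2 =
        (\<Sum>j\<le>Suc m. of_real (if j \<le> m then u * h j else 0) * (z1 ^ (Suc m - j) * z2 ^ j))"
      by (simp add: f sum_distrib_left Suc_diff_le mult_ac)
    have 2: "of_real v * z2 * f z1 z2 =
        (\<Sum>j\<le>Suc m. of_real (if j = 0 then 0 else v * h (j - 1)) * (z1 ^ (Suc m - j) * z2 ^ j))"
      by (subst sum.atMost_Suc_shift) (simp add: f sum_distrib_left mult_ac)
    show "(of_real u * z1 + of_real v * z2) * f z1 z2 =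
        (\<Sum>j\<le>Suc m. of_real (?h' j) * (z1 ^ (Suc m - j) * z2 ^ j))"
      using 1 2 by (simp only: distrib_right of_real_add sum.distrib)
  qed
  have base: "\<exists>h :: nat \<Rightarrow> real. \<forall>z1 z2 :: complex. (of_real c * z1 + of_real d * z2) ^ q =
      (\<Sum>j\<le>q. of_real (h j) * (z1 ^ (q - j) * z2 ^ j))"
  proof (induction q)
    case 0
    show ?case by (rule exI[of _ "\<lambda>_. 1"]) simp
  next
    case (Suc q)
    then obtain h :: "nat \<Rightarrow> real" where
      "\<forall>z1 z2 :: complex. (of_real c * z1 + of_real d * z2) ^ q =
        (\<Sum>j\<le>q. of_real (h j) * (z1 ^ (q - j) * z2 ^ j))" by blast
    from step[OF this, of c d] show ?case by simp
  qed
  show ?thesis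
  proof (induction p)
    case 0
    from base show ?case by simp
  next
    case (Suc p)
    then obtain h :: "nat \<Rightarrow> real" where
      "\<forall>z1 z2 :: complex. (of_real a * z1 + of_real b * z2) ^ p * (of_real c * z1 + of_real d * z2) ^ q =
        (\<Sum>j\<le>p + q. of_real (h j) * (z1 ^ (p + q - j) * z2 ^ j))" by blast
    from step[OF this, of a b] show ?case by (simp add: mult.assoc)
  qed
qed

lemma is_sym_mat_exists: "\<exists>M. is_sym_mat n \<gamma> M"
proof -
  define P where "P h i \<longleftrightarrow> (\<forall>z1 z2 :: complex.
    (of_real (\<gamma>$1$1) * z1 + of_real (\<gamma>$1$2) * z2) ^ (n - i) *
    (of_real (\<gamma>$2$1) * z1 + of_real (\<gamma>$2$2) * z2) ^ i =
      (\<Sum>j\<le>n. of_real (h j) * (z1 ^ (n - j) * z2 ^ j)))" for h :: "nat \<Rightarrow> real" and i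
  have "\<forall>i\<in>{..n}. \<exists>h. P h i"
  proof
    fix i assume "i \<in> {..n}"
    then have "n - i + i = n" by simp
    from linear_forms_expand[of "\<gamma>$1$1" "\<gamma>$1$2" "n - i" "\<gamma>$2$1" "\<gamma>$2$2" i, unfolded this]
    show "\<exists>h. P h i" unfolding P_def .
  qed
  from bchoice[OF this] obtain h where "\<forall>i\<in>{..n}. P (h i) i" by blast
  then have h: "\<And>i (z1::complex) (z2::complex). i \<le> n \<Longrightarrow>
    (of_real (\<gamma>$1$1) * z1 + of_real (\<gamma>$1$2) * z2) ^ (n - i) *
    (of_real (\<gamma>$2$1) * z1 + of_real (\<gamma>$2$2) * z2) ^ i =
      (\<Sum>j\<le>n. of_real (h i j) * (z1 ^ (n - j) * z2 ^ j))"
    by (simp add: P_def)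
  have "is_sym_mat n \<gamma> (Matrix.mat (n + 1) (n + 1) (\<lambda>(i, j). h i j))"
    unfolding is_sym_mat_def sym_vec_def
    by (auto intro!: eq_vecI simp: h scalar_prod_def atLeast0LessThan lessThan_Suc_atMost
        less_Suc_eq_le)
  then show ?thesis by blast
qed

lemma is_sym_mat_unique:
  assumes "is_sym_mat n \<gamma> M" "is_sym_mat n \<gamma> M'"
  shows "M = M'"
proof -
  have c: "M \<in> carrier_mat (n + 1) (n + 1)" "M' \<in> carrier_mat (n + 1) (n + 1)"
    using assms by (auto simp: is_sym_mat_def)
  have "M $$ (i, j) = M' $$ (i, j)" if ij: "i \<le> n" "j \<le> n" for i j
  proof -
    have "(\<Sum>j\<le>n. of_real (M $$ (i, j)) * z ^ j) = (\<Sum>j\<le>n. of_real (M' $$ (i, j)) * z ^ j)"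
      for z :: complex
    proof -
      have "vec_index (map_mat complex_of_real M *\<^sub>v sym_vec n 1 z) i =
            vec_index (map_mat complex_of_real M' *\<^sub>v sym_vec n 1 z) i"
        using assms by (simp add: is_sym_mat_def)
      then show ?thesis
        using c ij by (simp add: sym_vec_def scalar_prod_def atLeast0LessThan lessThan_Suc_atMost
            less_Suc_eq_le cong: sum.cong_simp)
    qed
    then have "\<forall>j\<le>n. complex_of_real (M $$ (i, j)) = of_real (M' $$ (i, j))"
      using polyfun_eq_coeffs[of "\<lambda>j. complex_of_real (M $$ (i, j))" n
          "\<lambda>j. complex_of_real (M' $$ (i, j))"] by blast
    with ij show ?thesis by simp
  qed
  with c show ?thesis by (intro eq_matI) auto
qed

lemma is_sym_mat_sym_rep: "is_sym_mat n \<gamma> (sym_rep n \<gamma>)"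
  unfolding sym_rep_def
  by (rule theI') (metis is_sym_mat_exists is_sym_mat_unique)

section \<open>The two function spaces\<close>

(* Functions on the upper half plane are represented by total functions vanishing off it,
   so that equality is equality on the half plane and pointwise operations stay inside. *)

definition Mhat ::
  "nat \<Rightarrow> int \<Rightarrow> (real^2^2) set \<Rightarrow> (real^2^2 \<Rightarrow> complex Matrix.mat) \<Rightarrow> (complex \<Rightarrow> complex Matrix.vec) set"
where
  "Mhat N k \<Gamma> \<rho> = {F.
     (\<forall>z. F z \<in> carrier_vec N) \<and>
     (\<forall>z. z \<notin> upper_half_plane \<longrightarrow> F z = 0\<^sub>v N) \<and>
     (\<forall>i<N. (\<lambda>z. vec_index (F z) i) holomorphic_on upper_half_plane) \<and>
     (\<forall>\<gamma>\<in>\<Gamma>. \<forall>z\<in>upper_half_plane. (JJ \<gamma> z powi (- k)) \<cdot>\<^sub>v F (act \<gamma> z) = \<rho> \<gamma> *\<^sub>v F z)}"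

(* \<open>poly_slash w \<gamma> \<Phi> z\<close> is the polynomial \<open>J^(-w) \<Phi>(\<gamma>z, J^2 (X - K))\<close> in \<open>X\<close>. *)
definition poly_slash ::
  "int \<Rightarrow> real^2^2 \<Rightarrow> (complex \<Rightarrow> complex poly) \<Rightarrow> complex \<Rightarrow> complex poly" where
  "poly_slash w \<gamma> \<Phi> z =
     (if z \<in> upper_half_plane
      then Polynomial.smult (JJ \<gamma> z powi (- w))
             (pcompose (\<Phi> (act \<gamma> z)) (Polynomial.smult ((JJ \<gamma> z)\<^sup>2) [: - KK \<gamma> z, 1 :]))
      else 0)"

definition QP :: "nat \<Rightarrow> int \<Rightarrow> (real^2^2) set \<Rightarrow> (complex \<Rightarrow> complex poly) set" where
  "QP m w \<Gamma> = {\<Phi>.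
     (\<forall>z. degree (\<Phi> z) \<le> m) \<and>
     (\<forall>z. z \<notin> upper_half_plane \<longrightarrow> \<Phi> z = 0) \<and>
     (\<forall>r\<le>m. (\<lambda>z. Polynomial.coeff (\<Phi> z) r) holomorphic_on upper_half_plane) \<and>
     (\<forall>\<gamma>\<in>\<Gamma>. \<forall>z\<in>upper_half_plane. poly_slash w \<gamma> \<Phi> z = \<Phi> z)}"

section \<open>Canonical isomorphisms\<close>

definition linear_iso_Mhat_QP ::
  "((complex \<Rightarrow> complex Matrix.vec) \<Rightarrow> (complex \<Rightarrow> complex poly)) \<Rightarrow>
   (complex \<Rightarrow> complex Matrix.vec) set \<Rightarrow> (complex \<Rightarrow> complex poly) set \<Rightarrow> bool" where
  "linear_iso_Mhat_QP T V W \<longleftrightarrow> bij_betw T V W \<and>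
     (\<forall>F\<in>V. \<forall>G\<in>V. T (\<lambda>z. F z + G z) = (\<lambda>z. T F z + T G z)) \<and>
     (\<forall>c. \<forall>F\<in>V. T (\<lambda>z. c \<cdot>\<^sub>v F z) = (\<lambda>z. Polynomial.smult c (T F z)))"

definition vec_slash ::
  "nat \<Rightarrow> int \<Rightarrow> (real^2^2 \<Rightarrow> complex Matrix.mat) \<Rightarrow> real^2^2 \<Rightarrow>
   (complex \<Rightarrow> complex Matrix.vec) \<Rightarrow> complex \<Rightarrow> complex Matrix.vec" where
  "vec_slash N k \<rho> g F z =
     (if z \<in> upper_half_plane
      then (JJ g z powi (- k)) \<cdot>\<^sub>v (\<rho> (inv\<^bsub>SL2R\<^esub> g) *\<^sub>v F (act g z))
      else 0\<^sub>v N)"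

(* Canonicity is naturality in the discrete group: whenever \<open>g \<Gamma>' g\<inverse> \<subseteq> \<Gamma>\<close>, slashing by \<open>g\<close>
   carries the spaces attached to \<open>\<Gamma>\<close> into those attached to \<open>\<Gamma>'\<close>, and the maps commute with it.
   The case \<open>g = 1\<close> is compatibility with restriction to a subgroup; the case \<open>\<Gamma> = g \<Gamma>' g\<inverse>\<close>
   is compatibility with conjugation. *)
definition natural_in_group ::
  "nat \<Rightarrow> int \<Rightarrow>
   ((real^2^2) set \<Rightarrow> (complex \<Rightarrow> complex Matrix.vec) \<Rightarrow> (complex \<Rightarrow> complex poly)) \<Rightarrow> bool" where
  "natural_in_group n k T \<longleftrightarrow>
     (\<forall>\<Gamma> \<Gamma>' g. discrete_subgroup \<Gamma> \<longrightarrow> discrete_subgroup \<Gamma>' \<longrightarrow> g \<in> carrier SL2R \<longrightarrow>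
        (\<forall>h\<in>\<Gamma>'. g \<otimes>\<^bsub>SL2R\<^esub> h \<otimes>\<^bsub>SL2R\<^esub> inv\<^bsub>SL2R\<^esub> g \<in> \<Gamma>) \<longrightarrow>
        (\<forall>F\<in>Mhat (n + 1) k \<Gamma> (sym_repC n).
           T \<Gamma>' (vec_slash (n + 1) k (sym_repC n) g F) = poly_slash (k + int n) g (T \<Gamma> F)))"

end

(* The n-th symmetric tensor representation carries an invariant pairing, normalised by
   <sym(z1, z2), sym(x, y)> = (z1 y - z2 x)^n. Pairing F(z) with the n-th tensor power of
   w(z, X) = (z X - 1, X) gives a polynomial in X of degree at most n, and since
   g w(z, X) = J^(-1) w(g z, J^2 (X - K)), this turns the slash action of any g in SL(2,R) on
   vector-valued functions of weight k into the one on polynomials of weight k + n. Pointwise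
   in z the map is invertible: up to binomial factors the entries of the vector are the
   coefficients of a polynomial H, and the image is X^n H(z - 1/X), i.e. a substitution and a
   coefficient reversal, both involutions that preserve holomorphic dependence on z. *)
theory Submission
  imports Defs
begin

section \<open>The action of SL(2,R)\<close>

lemma group_SL2R: "group SL2R"
proof (rule groupI)
  fix A assume "A \<in> carrier SL2R"
  then have d: "det A = 1" by (simp add: SL2R_def)
  then have "invertible A" by (simp add: invertible_det_nz)
  then obtain B where B: "A ** B = Finite_Cartesian_Product.mat 1"
    "B ** A = Finite_Cartesian_Product.mat 1" by (auto simp: invertible_def)
  then have "det B = 1" using d det_mul[of A B] by simp
  with B show "\<exists>B\<in>carrier SL2R. B \<otimes>\<^bsub>SL2R\<^esub> A = \<one>\<^bsub>SL2R\<^esub>"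
    by (auto simp: SL2R_def)
qed (auto simp: SL2R_def det_mul matrix_mul_assoc)

lemma SL2R_det:
  assumes "\<gamma> \<in> carrier SL2R"
  shows "\<gamma>$1$1 * \<gamma>$2$2 - \<gamma>$1$2 * \<gamma>$2$1 = 1"
  using assms by (simp add: SL2R_def det_2)

lemma SL2R_det_complex:
  assumes "\<gamma> \<in> carrier SL2R"
  shows "complex_of_real (\<gamma>$1$1) * of_real (\<gamma>$2$2) = 1 + of_real (\<gamma>$1$2) * of_real (\<gamma>$2$1)"
proof -
  have "\<gamma>$1$1 * \<gamma>$2$2 = 1 + \<gamma>$1$2 * \<gamma>$2$1" using SL2R_det[OF assms] by simp
  from arg_cong[OF this, of complex_of_real] show ?thesis by simp
qed

lemma JJ_nonzero:
  assumes "\<gamma> \<in> carrier SL2R" "z \<in> upper_half_plane"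
  shows "JJ \<gamma> z \<noteq> 0"
proof
  assume *: "JJ \<gamma> z = 0"
  then have "Im (JJ \<gamma> z) = 0" "Re (JJ \<gamma> z) = 0" by simp_all
  then have "\<gamma>$2$1 = 0" "\<gamma>$2$2 = 0"
    using assms(2) by (auto simp: JJ_def upper_half_plane_def)
  with SL2R_det[OF assms(1)] show False by simp
qed

lemma act_mult_JJ:
  assumes "\<gamma> \<in> carrier SL2R" "z \<in> upper_half_plane"
  shows "act \<gamma> z * JJ \<gamma> z = of_real (\<gamma>$1$1) * z + of_real (\<gamma>$1$2)"
  using JJ_nonzero[OF assms] by (simp add: act_def moebius_def JJ_def)

lemma KK_mult_JJ:
  assumes "\<gamma> \<in> carrier SL2R" "z \<in> upper_half_plane"
  shows "KK \<gamma> z * JJ \<gamma> z = of_real (\<gamma>$2$1)"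
  using JJ_nonzero[OF assms] by (simp add: KK_def)

text \<open>Multiplying numerator and denominator by the conjugate of J shows that the imaginary
  part of gz has the sign of (det g) * Im z, and det g = 1.\<close>

lemma act_in_upper_half_plane:
  assumes "\<gamma> \<in> carrier SL2R" "z \<in> upper_half_plane"
  shows "act \<gamma> z \<in> upper_half_plane"
proof -
  have "act \<gamma> z = (of_real (\<gamma>$1$1) * z + of_real (\<gamma>$1$2)) / JJ \<gamma> z"
    by (simp add: act_def moebius_def JJ_def)
  then have "Im (act \<gamma> z) > 0 \<longleftrightarrow>
      Im ((of_real (\<gamma>$1$1) * z + of_real (\<gamma>$1$2)) * cnj (JJ \<gamma> z)) > 0"
    by (simp only: Im_complex_div_gt_0)
  also have "Im ((of_real (\<gamma>$1$1) * z + of_real (\<gamma>$1$2)) * cnj (JJ \<gamma> z)) =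
      (\<gamma>$1$1 * \<gamma>$2$2 - \<gamma>$1$2 * \<gamma>$2$1) * Im z"
    by (simp add: JJ_def algebra_simps)
  finally show ?thesis
    using assms(2) by (simp add: upper_half_plane_def SL2R_det[OF assms(1)])
qed

section \<open>The invariant pairing on symmetric tensors\<close>

lemma sym_repC_carrier [simp]: "sym_repC n \<gamma> \<in> carrier_mat (n + 1) (n + 1)"
  using is_sym_mat_sym_rep[of n \<gamma>] by (simp add: sym_repC_def is_sym_mat_def)

lemma sym_repC_mult_carrier [simp]: "sym_repC n \<gamma> *\<^sub>v v \<in> carrier_vec (n + 1)"
  by (rule carrier_vecI) (use sym_repC_carrier[of n \<gamma>] in auto)

lemma sym_repC_sym_vec:
  "sym_repC n \<gamma> *\<^sub>v sym_vec n z1 z2 =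
     sym_vec n (of_real (\<gamma>$1$1) * z1 + of_real (\<gamma>$1$2) * z2)
               (of_real (\<gamma>$2$1) * z1 + of_real (\<gamma>$2$2) * z2)"
  using is_sym_mat_sym_rep[of n \<gamma>] by (simp add: sym_repC_def is_sym_mat_def)

section \<open>Multiplicativity of the symmetric tensor representation\<close>

lemma is_sym_mat_mult:
  assumes A: "is_sym_mat n A M" and B: "is_sym_mat n B M'"
  shows "is_sym_mat n (A ** B) (M * M')"
proof -
  have c: "M \<in> carrier_mat (n + 1) (n + 1)" "M' \<in> carrier_mat (n + 1) (n + 1)"
    using assms by (auto simp: is_sym_mat_def)
  have "map_mat complex_of_real (M * M') *\<^sub>v sym_vec n z1 z2 =
        map_mat complex_of_real M *\<^sub>v (map_mat complex_of_real M' *\<^sub>v sym_vec n z1 z2)" for z1 z2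
    using c by (subst of_real_hom.mat_hom_mult[OF c])
      (rule assoc_mult_mat_vec[of _ "n+1" "n+1" _ "n+1"], auto simp: sym_vec_def)
  moreover have "M * M' \<in> carrier_mat (n + 1) (n + 1)" by (rule mult_carrier_mat[OF c])
  ultimately show ?thesis
    using A B by (simp add: is_sym_mat_def matrix_matrix_mult_def sum_2 algebra_simps)
qed

lemma is_sym_mat_one: "is_sym_mat n (Finite_Cartesian_Product.mat 1) (1\<^sub>m (n + 1))"
  by (simp add: is_sym_mat_def Finite_Cartesian_Product.mat_def sym_vec_def of_real_hom.mat_hom_one)

text \<open>\<open>sym_rep\<close> is known only through its action on the vectors
  \<open>sym_vec\<close>. The product of the matrices of g and its inverse meets the specification
  for the identity, so uniqueness forces it to be \<open>1\<^sub>m (n + 1)\<close>. This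
  cancellation serves naturality, where \<open>vec_slash\<close> involves the inverse of g.\<close>

lemma sym_repC_inv:
  assumes g: "g \<in> carrier SL2R" and v: "v \<in> carrier_vec (n + 1)"
  shows "sym_repC n g *\<^sub>v (sym_repC n (inv\<^bsub>SL2R\<^esub> g) *\<^sub>v v) = v"
proof -
  let ?h = "inv\<^bsub>SL2R\<^esub> g"
  have "g ** ?h = Finite_Cartesian_Product.mat 1"
    using group.r_inv[OF group_SL2R g] by (simp add: SL2R_def)
  then have "is_sym_mat n (Finite_Cartesian_Product.mat 1) (sym_rep n g * sym_rep n ?h)"
    using is_sym_mat_mult[OF is_sym_mat_sym_rep is_sym_mat_sym_rep, of n g ?h] by simp
  then have 1: "sym_rep n g * sym_rep n ?h = 1\<^sub>m (n + 1)"
    using is_sym_mat_one is_sym_mat_unique by blast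
  have c: "sym_rep n g \<in> carrier_mat (n + 1) (n + 1)" "sym_rep n ?h \<in> carrier_mat (n + 1) (n + 1)"
    using is_sym_mat_sym_rep by (auto simp: is_sym_mat_def)
  have "sym_repC n g * sym_repC n ?h = 1\<^sub>m (n + 1)"
    unfolding sym_repC_def of_real_hom.mat_hom_mult[OF c, symmetric] 1
    by (rule of_real_hom.mat_hom_one)
  then show ?thesis
    using assoc_mult_mat_vec[OF sym_repC_carrier[of n g] sym_repC_carrier[of n ?h] v] v by simp
qed

text \<open>The invariant pairing of v with the n-th tensor power of (x, y). Signs and binomial
  coefficients are chosen so that on pure powers it becomes the n-th power of a 2x2
  determinant.\<close>

definition tensor_form :: "nat \<Rightarrow> complex \<Rightarrow> complex \<Rightarrow> complex Matrix.vec \<Rightarrow> complex" where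
  "tensor_form n x y v =
     (\<Sum>i\<le>n. (-1) ^ i * of_nat (n choose i) * x ^ i * y ^ (n - i) * vec_index v i)"

lemma tensor_form_sym_vec: "tensor_form n x y (sym_vec n a b) = (a * y - b * x) ^ n"
proof -
  have "(a * y - b * x) ^ n = (- (b * x) + a * y) ^ n" by simp
  also have "\<dots> = (\<Sum>i\<le>n. of_nat (n choose i) * (- (b * x)) ^ i * (a * y) ^ (n - i))"
    by (rule binomial_ring)
  also have "\<dots> = tensor_form n x y (sym_vec n a b)"
    unfolding tensor_form_def
    by (rule sum.cong) (auto simp: sym_vec_def power_minus[of "b * x"] power_mult_distrib)
  finally show ?thesis ..
qed

lemma tensor_form_scale: "tensor_form n (c * x) (c * y) v = c ^ n * tensor_form n x y v"
proof -
  have "c ^ n = c ^ i * c ^ (n - i)" if "i \<le> n" for i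
    using that by (simp flip: power_add)
  then show ?thesis
    by (auto simp: tensor_form_def sum_distrib_left power_mult_distrib intro!: sum.cong)
qed

text \<open>Both sides are linear in v, so it suffices to compare them on pure powers of (1, t).
  There they are n-th powers of determinants, which g preserves because det g = 1.\<close>

lemma tensor_form_sym_repC:
  assumes g: "\<gamma> \<in> carrier SL2R" and v: "v \<in> carrier_vec (n + 1)"
  shows "tensor_form n (of_real (\<gamma>$1$1) * x + of_real (\<gamma>$1$2) * y)
      (of_real (\<gamma>$2$1) * x + of_real (\<gamma>$2$2) * y) (sym_repC n \<gamma> *\<^sub>v v) = tensor_form n x y v"
    (is "tensor_form n ?x ?y _ = _")
proof -
  define A where "A j = (\<Sum>i\<le>n. (-1) ^ i * of_nat (n choose i) * ?x ^ i * ?y ^ (n - i) *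
    sym_repC n \<gamma> $$ (i, j))" for j
  define B where "B j = (-1) ^ j * of_nat (n choose j) * x ^ j * y ^ (n - j)" for j
  have dims: "dim_row (sym_repC n \<gamma>) = Suc n" "dim_col (sym_repC n \<gamma>) = Suc n"
    using sym_repC_carrier[of n \<gamma>] by auto
  have A: "tensor_form n ?x ?y (sym_repC n \<gamma> *\<^sub>v u) = (\<Sum>j\<le>n. A j * vec_index u j)"
    if "u \<in> carrier_vec (n + 1)" for u
  proof -
    have "vec_index (sym_repC n \<gamma> *\<^sub>v u) i = (\<Sum>j\<le>n. sym_repC n \<gamma> $$ (i, j) * vec_index u j)"
      if "i \<le> n" for i
      using that \<open>u \<in> carrier_vec (n + 1)\<close> dims
      by (auto simp: scalar_prod_def atLeast0LessThan lessThan_Suc_atMost intro!: sum.cong)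
    then have "tensor_form n ?x ?y (sym_repC n \<gamma> *\<^sub>v u) =
      (\<Sum>i\<le>n. \<Sum>j\<le>n. (-1) ^ i * of_nat (n choose i) * ?x ^ i * ?y ^ (n - i) *
        sym_repC n \<gamma> $$ (i, j) * vec_index u j)"
      by (simp add: tensor_form_def sum_distrib_left mult.assoc)
    also have "\<dots> = (\<Sum>j\<le>n. A j * vec_index u j)"
      by (subst sum.swap) (simp add: A_def sum_distrib_right)
    finally show ?thesis .
  qed
  have B: "tensor_form n x y u = (\<Sum>j\<le>n. B j * vec_index u j)" for u
    by (simp add: tensor_form_def B_def)
  \<comment> \<open>The entries of \<open>sym_vec n 1 t\<close> are the powers of t, so evaluating
    the two linear forms on it gives polynomials in t. Their agreement for all t identifies the
    coefficients A and B.\<close>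
  have "(\<Sum>j\<le>n. A j * t ^ j) = (\<Sum>j\<le>n. B j * t ^ j)" for t
  proof -
    have s: "sym_vec n 1 t \<in> carrier_vec (n + 1)" "\<And>j. j \<le> n \<Longrightarrow> vec_index (sym_vec n 1 t) j = t ^ j"
      by (auto simp: sym_vec_def)
    have "(of_real (\<gamma>$1$1) + of_real (\<gamma>$1$2) * t) * ?y - (of_real (\<gamma>$2$1) + of_real (\<gamma>$2$2) * t) * ?x
        = (complex_of_real (\<gamma>$1$1) * of_real (\<gamma>$2$2) - of_real (\<gamma>$1$2) * of_real (\<gamma>$2$1)) * (y - t * x)"
      by (simp add: algebra_simps)
    also have "\<dots> = y - t * x"
      by (simp add: SL2R_det_complex[OF g])
    finally have "tensor_form n ?x ?y (sym_repC n \<gamma> *\<^sub>v sym_vec n 1 t) = tensor_form n x y (sym_vec n 1 t)"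
      by (simp add: sym_repC_sym_vec tensor_form_sym_vec)
    then show ?thesis using A[OF s(1)] B s(2) by simp
  qed
  then have "\<forall>j\<le>n. A j = B j" using polyfun_eq_coeffs[of A n B] by blast
  then show ?thesis using A[OF v] B by simp
qed

section \<open>From vectors to polynomials\<close>

definition tensor_poly :: "nat \<Rightarrow> complex \<Rightarrow> complex Matrix.vec \<Rightarrow> complex poly" where
  "tensor_poly n z v = (\<Sum>i\<le>n. Polynomial.smult ((-1) ^ i * of_nat (n choose i) * vec_index v i)
     ([:0, 1:] ^ (n - i) * [:-1, z:] ^ i))"

lemma poly_tensor_poly: "poly (tensor_poly n z v) x = tensor_form n (x * z - 1) x v"
  by (simp add: tensor_poly_def tensor_form_def poly_sum poly_power mult_ac)

lemma tensor_poly_add: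
  assumes "v \<in> carrier_vec (n + 1)" "w \<in> carrier_vec (n + 1)"
  shows "tensor_poly n z (v + w) = tensor_poly n z v + tensor_poly n z w"
proof -
  have "poly (tensor_poly n z (v + w)) x = poly (tensor_poly n z v + tensor_poly n z w) x" for x
    unfolding poly_add poly_tensor_poly tensor_form_def sum.distrib[symmetric]
    by (rule sum.cong) (use assms in \<open>auto simp: distrib_left\<close>)
  then show ?thesis by (simp add: poly_eq_poly_eq_iff[symmetric] fun_eq_iff)
qed

lemma tensor_poly_smult:
  assumes "v \<in> carrier_vec (n + 1)"
  shows "tensor_poly n z (c \<cdot>\<^sub>v v) = Polynomial.smult c (tensor_poly n z v)"
proof -
  have "poly (tensor_poly n z (c \<cdot>\<^sub>v v)) x = poly (Polynomial.smult c (tensor_poly n z v)) x" for x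
    using assms by (auto simp: poly_tensor_poly tensor_form_def sum_distrib_left intro!: sum.cong)
  then show ?thesis by (simp add: poly_eq_poly_eq_iff[symmetric] fun_eq_iff)
qed

lemma tensor_poly_zero [simp]: "tensor_poly n z (0\<^sub>v (Suc n)) = 0"
  by (simp add: tensor_poly_def)

text \<open>The vector w(gz, J^2 (X - K)) equals J times g w(z, X). Homogeneity of degree n in w
  yields the factor J^n, and invariance of the pairing removes g.\<close>

lemma tensor_poly_equivariant:
  assumes g: "g \<in> carrier SL2R" and z: "z \<in> upper_half_plane" and v: "v \<in> carrier_vec (n + 1)"
  shows "pcompose (tensor_poly n (act g z) (sym_repC n g *\<^sub>v v))
           (Polynomial.smult ((JJ g z)\<^sup>2) [:- KK g z, 1:]) =
         Polynomial.smult (JJ g z ^ n) (tensor_poly n z v)"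
proof -
  let ?J = "JJ g z" and ?K = "KK g z"
  have "tensor_form n (?J\<^sup>2 * (x - ?K) * act g z - 1) (?J\<^sup>2 * (x - ?K)) (sym_repC n g *\<^sub>v v) =
        ?J ^ n * tensor_form n (x * z - 1) x v" for x
  proof -
    \<comment> \<open>These are the two coordinates of g applied to (x z - 1, x).\<close>
    let ?x = "of_real (g$1$1) * (x * z - 1) + of_real (g$1$2) * x"
    let ?y = "of_real (g$2$1) * (x * z - 1) + of_real (g$2$2) * x"
    have y: "?J\<^sup>2 * (x - ?K) = ?J * ?y"
    proof -
      have "?J * (x - ?K) = ?J * x - ?K * ?J" by (simp add: algebra_simps)
      also have "\<dots> = ?y" unfolding KK_mult_JJ[OF g z] by (simp add: JJ_def algebra_simps)
      finally show ?thesis by (simp add: power2_eq_square mult.assoc)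
    qed
    have "?J\<^sup>2 * (x - ?K) * act g z - 1 = ?y * (act g z * ?J) - 1"
      by (simp only: y) (simp only: mult_ac)
    also have "\<dots> = ?J * ?x"
    \<comment> \<open>The constant -1 in the first coordinate is absorbed by the determinant of
      g.\<close>
    proof -
      have "?y * (of_real (g$1$1) * z + of_real (g$1$2)) =
          ?J * ?x + (of_real (g$1$1) * of_real (g$2$2) - of_real (g$1$2) * of_real (g$2$1))"
        by (simp add: JJ_def algebra_simps)
      then show ?thesis by (simp add: act_mult_JJ[OF g z] SL2R_det_complex[OF g])
    qed
    finally show ?thesis
      unfolding y by (simp only: tensor_form_scale tensor_form_sym_repC[OF g v])
  qed
  then have "poly (pcompose (tensor_poly n (act g z) (sym_repC n g *\<^sub>v v))
           (Polynomial.smult (?J\<^sup>2) [:- ?K, 1:])) x =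
         poly (Polynomial.smult (?J ^ n) (tensor_poly n z v)) x" for x
    by (simp add: poly_pcompose poly_tensor_poly algebra_simps)
  then show ?thesis by (simp add: poly_eq_poly_eq_iff[symmetric] fun_eq_iff)
qed

section \<open>Pointwise inversion by coefficient reversal and substitution\<close>

definition poly_flip :: "nat \<Rightarrow> complex poly \<Rightarrow> complex poly" where
  "poly_flip n p = (\<Sum>r\<le>n. Polynomial.monom (Polynomial.coeff p r) (n - r))"

lemma coeff_poly_flip:
  "Polynomial.coeff (poly_flip n p) r = (if r \<le> n then Polynomial.coeff p (n - r) else 0)"
proof -
  \<comment> \<open>The conjunct r \<le> n guards against truncated subtraction: for r > n the index
    n - r is 0 and would wrongly select s = 0.\<close>
  have "Polynomial.coeff (poly_flip n p) r =
      (\<Sum>s\<le>n. if s = n - r \<and> r \<le> n then Polynomial.coeff p s else 0)"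
    unfolding poly_flip_def coeff_sum by (rule sum.cong) auto
  then show ?thesis by simp
qed

lemma degree_poly_flip: "degree (poly_flip n p) \<le> n"
  by (rule degree_le) (simp add: coeff_poly_flip)

text \<open>The reversal has the fixed length n rather than the degree of p. Hence it is an
  involution even on polynomials whose constant coefficient vanishes, where reversing at the degree
  would lose a power of X.\<close>

lemma poly_flip_flip:
  assumes "degree p \<le> n"
  shows "poly_flip n (poly_flip n p) = p"
  using assms by (intro poly_eqI) (auto simp: coeff_poly_flip coeff_eq_0)

lemma poly_poly_flip:
  assumes "degree p \<le> n" "x \<noteq> 0"
  shows "poly (poly_flip n p) x = x ^ n * poly p (1 / x)"
proof -
  have "poly p (1 / x) = (\<Sum>r\<le>n. Polynomial.coeff p r * (1 / x) ^ r)"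
    unfolding poly_altdef
    by (rule sum.mono_neutral_left) (use assms in \<open>auto simp: coeff_eq_0\<close>)
  then show ?thesis
    using \<open>x \<noteq> 0\<close>
    by (auto simp: poly_flip_def poly_sum poly_monom sum_distrib_left power_diff power_divide intro!: sum.cong)
qed

text \<open>Multiplication by X makes the values at 0 agree, and X can then be cancelled.\<close>

lemma poly_eq_off_zero:
  fixes p q :: "complex poly"
  assumes "\<And>x. x \<noteq> 0 \<Longrightarrow> poly p x = poly q x"
  shows "p = q"
proof -
  have "poly ([:0, 1:] * p) x = poly ([:0, 1:] * q) x" for x
    using assms by (cases "x = 0") auto
  then have "[:0, 1:] * p = [:0, 1:] * q"
    by (simp add: poly_eq_poly_eq_iff[symmetric] fun_eq_iff)
  then show ?thesis by simp
qed

text \<open>The polynomial H of the overview: the pairing of v with the tensor power of (Y, 1), as a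
  polynomial in Y.\<close>

definition binomial_poly :: "nat \<Rightarrow> complex Matrix.vec \<Rightarrow> complex poly" where
  "binomial_poly n v =
     (\<Sum>i\<le>n. Polynomial.monom ((-1) ^ i * of_nat (n choose i) * vec_index v i) i)"

lemma coeff_binomial_poly:
  "Polynomial.coeff (binomial_poly n v) i =
     (if i \<le> n then (-1) ^ i * of_nat (n choose i) * vec_index v i else 0)"
  by (simp add: binomial_poly_def coeff_sum)

lemma degree_binomial_poly: "degree (binomial_poly n v) \<le> n"
  by (rule degree_le) (simp add: coeff_binomial_poly)

lemma degree_pcompose_linear: "degree (pcompose p [:z, -1:]) = degree (p :: complex poly)"
  by (simp add: degree_pcompose)

text \<open>z - (z - X) = X.\<close>

lemma pcompose_linear_involution: "pcompose (pcompose p [:z, -1:]) [:z, -1:] = (p :: complex poly)"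
  by (simp add: pcompose_assoc[symmetric] pcompose_pCons)

text \<open>For x nonzero, (x z - 1, x) is x times (z - 1/x, 1), so by homogeneity the pairing is
  x^n H(z - 1/x). The excluded point x = 0 is covered by \<open>poly_eq_off_zero\<close>.\<close>

lemma tensor_poly_eq_flip:
  "tensor_poly n z v = poly_flip n (pcompose (binomial_poly n v) [:z, -1:])"
proof (rule poly_eq_off_zero)
  fix x :: complex assume x: "x \<noteq> 0"
  have "x ^ n * (z - 1 / x) ^ i = (x * z - 1) ^ i * x ^ (n - i)" if "i \<le> n" for i
  proof -
    have "x ^ n = x ^ i * x ^ (n - i)" using that by (simp flip: power_add)
    then have "x ^ n * (z - 1 / x) ^ i = (x * (z - 1 / x)) ^ i * x ^ (n - i)"
      by (simp only: power_mult_distrib mult_ac)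
    also have "x * (z - 1 / x) = x * z - 1" using x by (simp add: algebra_simps)
    finally show ?thesis .
  qed
  then have "tensor_form n (x * z - 1) x v = x ^ n * poly (binomial_poly n v) (z - 1 / x)"
    by (auto simp: tensor_form_def binomial_poly_def poly_sum poly_monom sum_distrib_left mult_ac
        intro!: sum.cong)
  then show "poly (tensor_poly n z v) x = poly (poly_flip n (pcompose (binomial_poly n v) [:z, -1:])) x"
    using x by (simp add: poly_tensor_poly poly_poly_flip degree_pcompose_linear degree_binomial_poly
        poly_pcompose)
qed

lemma degree_tensor_poly: "degree (tensor_poly n z v) \<le> n"
  by (simp add: tensor_poly_eq_flip degree_poly_flip)

text \<open>Undoes the factors of \<open>tensor_poly_eq_flip\<close> in reverse order: first the
  reversal, then the substitution, then the signed binomial factors, which are nonzero for i \<le>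
  n.\<close>

definition tensor_vec :: "nat \<Rightarrow> complex \<Rightarrow> complex poly \<Rightarrow> complex Matrix.vec" where
  "tensor_vec n z p = Matrix.vec (n + 1)
     (\<lambda>i. Polynomial.coeff (pcompose (poly_flip n p) [:z, -1:]) i / ((-1) ^ i * of_nat (n choose i)))"

lemma tensor_vec_carrier [simp]: "tensor_vec n z p \<in> carrier_vec (n + 1)"
  by (simp add: tensor_vec_def)

lemma tensor_vec_zero [simp]: "tensor_vec n z 0 = 0\<^sub>v (Suc n)"
  by (auto simp: tensor_vec_def poly_flip_def)

lemma tensor_vec_tensor_poly:
  assumes "v \<in> carrier_vec (n + 1)"
  shows "tensor_vec n z (tensor_poly n z v) = v"
proof -
  have "pcompose (poly_flip n (tensor_poly n z v)) [:z, -1:] = binomial_poly n v"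
    by (simp add: tensor_poly_eq_flip poly_flip_flip degree_pcompose_linear degree_binomial_poly
        pcompose_linear_involution)
  with assms show ?thesis
    by (intro eq_vecI) (auto simp: tensor_vec_def coeff_binomial_poly)
qed

lemma tensor_poly_tensor_vec:
  assumes "degree p \<le> n"
  shows "tensor_poly n z (tensor_vec n z p) = p"
proof -
  let ?q = "pcompose (poly_flip n p) [:z, -1:]"
  have "degree ?q \<le> n" by (simp add: degree_pcompose_linear degree_poly_flip)
  then have "binomial_poly n (tensor_vec n z p) = ?q"
    by (intro poly_eqI) (auto simp: coeff_binomial_poly tensor_vec_def coeff_eq_0)
  then show ?thesis
    using assms by (simp add: tensor_poly_eq_flip pcompose_linear_involution poly_flip_flip)
qed

section \<open>Holomorphic families of polynomials\<close>

text \<open>All coefficients are required to be holomorphic, without a degree bound, so that closure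
  under products and powers needs no bookkeeping of degrees.\<close>

definition holomorphic_poly_on :: "(complex \<Rightarrow> complex poly) \<Rightarrow> complex set \<Rightarrow> bool" where
  "holomorphic_poly_on p S \<longleftrightarrow> (\<forall>r. (\<lambda>z. Polynomial.coeff (p z) r) holomorphic_on S)"

lemma holomorphic_poly_on_const: "holomorphic_poly_on (\<lambda>_. p) S"
  by (simp add: holomorphic_poly_on_def)

lemma holomorphic_poly_on_linear:
  assumes "f holomorphic_on S" "g holomorphic_on S"
  shows "holomorphic_poly_on (\<lambda>z. [:f z, g z:]) S"
proof -
  have "Polynomial.coeff [:f z, g z:] r = (if r = 0 then f z else if r = 1 then g z else 0)" for z r
    by (simp add: coeff_pCons split: nat.split)
  moreover have "(\<lambda>z. if r = 0 then f z else if r = 1 then g z else 0) holomorphic_on S" for r :: nat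
    using assms by (cases "r = 0"; cases "r = 1") auto
  ultimately show ?thesis by (simp only: holomorphic_poly_on_def simp_thms)
qed

lemma holomorphic_poly_on_smult:
  assumes "f holomorphic_on S" "holomorphic_poly_on p S"
  shows "holomorphic_poly_on (\<lambda>z. Polynomial.smult (f z) (p z)) S"
  using assms by (auto simp: holomorphic_poly_on_def intro!: holomorphic_intros)

lemma holomorphic_poly_on_sum:
  assumes "\<And>i. i \<in> I \<Longrightarrow> holomorphic_poly_on (p i) S"
  shows "holomorphic_poly_on (\<lambda>z. \<Sum>i\<in>I. p i z) S"
  using assms by (auto simp: holomorphic_poly_on_def coeff_sum intro!: holomorphic_intros)

lemma holomorphic_poly_on_mult:
  assumes "holomorphic_poly_on p S" "holomorphic_poly_on q S"
  shows "holomorphic_poly_on (\<lambda>z. p z * q z) S"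
  using assms by (auto simp: holomorphic_poly_on_def coeff_mult intro!: holomorphic_intros)

lemma holomorphic_poly_on_power:
  assumes "holomorphic_poly_on p S"
  shows "holomorphic_poly_on (\<lambda>z. p z ^ m) S"
  by (induction m) (auto intro: assms holomorphic_poly_on_const holomorphic_poly_on_mult)

lemma holomorphic_tensor_poly:
  assumes "\<And>i. i < n + 1 \<Longrightarrow> (\<lambda>z. vec_index (F z) i) holomorphic_on S"
  shows "holomorphic_poly_on (\<lambda>z. tensor_poly n z (F z)) S"
  unfolding tensor_poly_def
  by (intro holomorphic_poly_on_sum holomorphic_poly_on_smult holomorphic_poly_on_mult
      holomorphic_poly_on_power holomorphic_poly_on_const holomorphic_poly_on_linear
      holomorphic_intros assms) auto

text \<open>The summation range depends only on the bound n. For a family p(z) it therefore does not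
  vary with z, even if the degree does, and holomorphy can be checked term by term.\<close>

lemma pcompose_eq_sum:
  fixes p q :: "complex poly"
  assumes "degree p \<le> n"
  shows "pcompose p q = (\<Sum>i\<le>n. Polynomial.smult (Polynomial.coeff p i) (q ^ i))"
proof -
  have "poly p y = (\<Sum>i\<le>n. Polynomial.coeff p i * y ^ i)" for y
    unfolding poly_altdef
    by (rule sum.mono_neutral_left) (use assms in \<open>auto simp: coeff_eq_0\<close>)
  then show ?thesis
    by (simp add: poly_eq_poly_eq_iff[symmetric] fun_eq_iff poly_pcompose poly_sum poly_power)
qed

lemma holomorphic_tensor_vec:
  assumes "\<And>r. r \<le> n \<Longrightarrow> (\<lambda>z. Polynomial.coeff (p z) r) holomorphic_on S" "i < n + 1"
  shows "(\<lambda>z. vec_index (tensor_vec n z (p z)) i) holomorphic_on S"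
proof -
  have "holomorphic_poly_on (\<lambda>z. \<Sum>j\<le>n. Polynomial.smult (Polynomial.coeff (poly_flip n (p z)) j)
      ([:z, -1:] ^ j)) S"
    by (intro holomorphic_poly_on_sum holomorphic_poly_on_smult
      holomorphic_poly_on_power holomorphic_poly_on_linear holomorphic_intros)
      (auto simp: coeff_poly_flip assms)
  then have "(\<lambda>z. Polynomial.coeff (pcompose (poly_flip n (p z)) [:z, -1:]) i) holomorphic_on S"
    by (simp add: pcompose_eq_sum[OF degree_poly_flip] holomorphic_poly_on_def)
  with assms(2) show ?thesis
    by (auto simp: tensor_vec_def intro!: holomorphic_intros)
qed

section \<open>The isomorphism\<close>

text \<open>Leaving v arbitrary lets one equivalence serve twice: v = F z gives the transformation
  laws defining the two spaces, and v = the slashed vector gives naturality. It is an equivalence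
  because \<open>tensor_poly\<close> at a fixed point, composition with \<open>?l\<close> and
  scaling by a nonzero constant are all injective.\<close>

lemma poly_slash_tensor_poly:
  assumes g: "g \<in> carrier SL2R" and z: "z \<in> upper_half_plane" and v: "v \<in> carrier_vec (n + 1)"
    and F: "F (act g z) \<in> carrier_vec (n + 1)"
  shows "poly_slash (k + int n) g (\<lambda>z. tensor_poly n z (F z)) z = tensor_poly n z v \<longleftrightarrow>
         (JJ g z powi (- k)) \<cdot>\<^sub>v F (act g z) = sym_repC n g *\<^sub>v v"
proof -
  let ?J = "JJ g z"
  let ?l = "Polynomial.smult (?J\<^sup>2) [:- KK g z, 1:]"
  let ?P = "tensor_poly n (act g z)"
  have J: "?J \<noteq> 0" by (rule JJ_nonzero[OF g z])
  \<comment> \<open>The weight shift from k to k + n contributes J^(-n), which cancels the J^n of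
    \<open>tensor_poly_equivariant\<close>.\<close>
  then have Jp: "?J powi (- (k + int n)) = inverse (?J ^ n) * ?J powi (- k)"
    by (simp add: power_int_diff power_int_minus field_simps)
  have "poly_slash (k + int n) g (\<lambda>z. tensor_poly n z (F z)) z =
      Polynomial.smult (inverse (?J ^ n)) (pcompose (?P ((?J powi (- k)) \<cdot>\<^sub>v F (act g z))) ?l)"
    unfolding poly_slash_def Jp using z F by (simp add: tensor_poly_smult pcompose_smult)
  moreover have "tensor_poly n z v =
      Polynomial.smult (inverse (?J ^ n)) (pcompose (?P (sym_repC n g *\<^sub>v v)) ?l)"
    unfolding tensor_poly_equivariant[OF g z v] using J by simp
  \<comment> \<open>Since J is nonzero, \<open>?l\<close> has degree 1, so composing the difference
    p - q with it gives zero only for p = q.\<close>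
  moreover have "pcompose p ?l = pcompose q ?l \<longleftrightarrow> p = q" for p q :: "complex poly"
    using pcompose_eq_0[of "p - q" ?l] J by (auto simp: pcompose_diff)
  moreover have "?P u = ?P w \<longleftrightarrow> u = w" if "u \<in> carrier_vec (n + 1)" "w \<in> carrier_vec (n + 1)" for u w
    using that tensor_vec_tensor_poly by metis
  moreover have "Polynomial.smult c p = Polynomial.smult c q \<longleftrightarrow> p = q" if "c \<noteq> 0"
    for c and p q :: "complex poly"
    using smult_eq_0_iff[of c "p - q"] that by (simp add: smult_diff_right)
  ultimately show ?thesis
    using J F sym_repC_mult_carrier by (simp only: smult_carrier_vec) simp
qed

theorem theorem1p3:
  fixes k :: int and n :: nat
  assumes "k > int n"
  shows "\<exists>T :: (real^2^2) set \<Rightarrow> (complex \<Rightarrow> complex Matrix.vec) \<Rightarrow> (complex \<Rightarrow> complex poly).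
    (\<forall>\<Gamma>. discrete_subgroup \<Gamma> \<longrightarrow>
       linear_iso_Mhat_QP (T \<Gamma>) (Mhat (n + 1) k \<Gamma> (sym_repC n)) (QP n (k + int n) \<Gamma>)) \<and>
    natural_in_group n k T"
proof -
  \<comment> \<open>One pointwise formula, not depending on the group, serves every \<Gamma>; S is
    its pointwise inverse.\<close>
  define T where "T F = (\<lambda>z. tensor_poly n z (F z))" for F :: "complex \<Rightarrow> complex Matrix.vec"
  define S where "S \<Phi> = (\<lambda>z. tensor_vec n z (\<Phi> z))" for \<Phi> :: "complex \<Rightarrow> complex poly"
  have "linear_iso_Mhat_QP T (Mhat (n + 1) k \<Gamma> (sym_repC n)) (QP n (k + int n) \<Gamma>)"
    if "discrete_subgroup \<Gamma>" for \<Gamma>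
  proof -
    let ?M = "Mhat (n + 1) k \<Gamma> (sym_repC n)" and ?Q = "QP n (k + int n) \<Gamma>"
    have \<Gamma>: "g \<in> carrier SL2R" if "g \<in> \<Gamma>" for g
      using \<open>discrete_subgroup \<Gamma>\<close> that by (auto simp: discrete_subgroup_def dest: subgroup.mem_carrier)
    have Mc: "F z \<in> carrier_vec (n + 1)" if "F \<in> ?M" for F z
      using that by (simp add: Mhat_def)
    have Qd: "degree (\<Phi> z) \<le> n" if "\<Phi> \<in> ?Q" for \<Phi> z
      using that by (simp add: QP_def)
    \<comment> \<open>Used from left to right to place T F in \<open>?Q\<close>, and from right to
      left to place S \<Phi> in \<open>?M\<close>.\<close>
    have slash: "(\<forall>\<gamma>\<in>\<Gamma>. \<forall>z\<in>upper_half_plane. (JJ \<gamma> z powi (- k)) \<cdot>\<^sub>v F (act \<gamma> z) = sym_repC n \<gamma> *\<^sub>v F z) \<longleftrightarrow>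
        (\<forall>\<gamma>\<in>\<Gamma>. \<forall>z\<in>upper_half_plane. poly_slash (k + int n) \<gamma> (T F) z = T F z)"
      if "\<And>z. F z \<in> carrier_vec (n + 1)" for F
      unfolding T_def by (intro ball_cong refl poly_slash_tensor_poly[symmetric] \<Gamma> that)
    have TQ: "T F \<in> ?Q" if F: "F \<in> ?M" for F
      using F slash[of F] holomorphic_tensor_poly[of n F upper_half_plane]
      by (simp add: QP_def Mhat_def T_def degree_tensor_poly holomorphic_poly_on_def)
    have TS: "T (S \<Phi>) = \<Phi>" if "\<Phi> \<in> ?Q" for \<Phi>
      using Qd[OF that] by (simp add: T_def S_def tensor_poly_tensor_vec)
    have ST: "S (T F) = F" if "F \<in> ?M" for F
      using Mc[OF that] by (simp add: T_def S_def tensor_vec_tensor_poly)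
    have SM: "S \<Phi> \<in> ?M" if \<Phi>: "\<Phi> \<in> ?Q" for \<Phi>
    proof -
      have c: "S \<Phi> z \<in> carrier_vec (n + 1)" for z by (simp only: S_def tensor_vec_carrier)
      have "\<forall>i<n + 1. (\<lambda>z. vec_index (S \<Phi> z) i) holomorphic_on upper_half_plane"
        unfolding S_def using \<Phi> by (intro allI impI holomorphic_tensor_vec) (auto simp: QP_def)
      moreover have "\<forall>z. z \<notin> upper_half_plane \<longrightarrow> S \<Phi> z = 0\<^sub>v (n + 1)"
        using \<Phi> by (simp add: QP_def S_def)
      moreover have "\<forall>\<gamma>\<in>\<Gamma>. \<forall>z\<in>upper_half_plane.
          (JJ \<gamma> z powi (- k)) \<cdot>\<^sub>v S \<Phi> (act \<gamma> z) = sym_repC n \<gamma> *\<^sub>v S \<Phi> z"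
        using slash[of "S \<Phi>"] c \<Phi> by (simp add: TS[OF \<Phi>] QP_def)
      ultimately show ?thesis using c unfolding Mhat_def by blast
    qed
    have "bij_betw T ?M ?Q"
      by (rule bij_betw_byWitness[where f' = S]) (use TS ST TQ SM in auto)
    then show ?thesis
      unfolding linear_iso_Mhat_QP_def
      by (auto simp only: T_def tensor_poly_add tensor_poly_smult Mc)
  qed
  moreover have "natural_in_group n k (\<lambda>_. T)"
    unfolding natural_in_group_def
  proof (intro allI impI ballI ext)
    fix \<Gamma> :: "(real^2^2) set" and g F z
    assume g: "g \<in> carrier SL2R" and "F \<in> Mhat (n + 1) k \<Gamma> (sym_repC n)"
    then have F: "F z \<in> carrier_vec (n + 1)" for z by (simp add: Mhat_def)
    show "T (vec_slash (n + 1) k (sym_repC n) g F) z = poly_slash (k + int n) g (T F) z"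
    proof (cases "z \<in> upper_half_plane")
      case True
      let ?v = "vec_slash (n + 1) k (sym_repC n) g F z"
      let ?u = "(JJ g z powi (- k)) \<cdot>\<^sub>v F (act g z)"
      have u: "?u \<in> carrier_vec (n + 1)" using F by simp
      have v: "?v = sym_repC n (inv\<^bsub>SL2R\<^esub> g) *\<^sub>v ?u"
        using True mult_mat_vec[OF sym_repC_carrier F] by (simp add: vec_slash_def)
      have "?v \<in> carrier_vec (n + 1)" unfolding v by (rule sym_repC_mult_carrier)
      \<comment> \<open>For this v the vector side of the equivalence reads u = sym(g) sym(g^(-1))
        u, which \<open>sym_repC_inv\<close> makes true.\<close>
      from poly_slash_tensor_poly[of g z ?v n F k, OF g True this F]
      have "poly_slash (k + int n) g (T F) z = tensor_poly n z ?v"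
        unfolding T_def v sym_repC_inv[OF g u] by simp
      then show ?thesis by (simp add: T_def)
    next
      case False
      then show ?thesis by (simp add: T_def vec_slash_def poly_slash_def)
    qed
  qed
  ultimately show ?thesis by (intro exI[of _ "\<lambda>_. T"]) simp
qed

end
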